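(* Let $M$ be an $(N-k)\times N$ matrix over $\mathbb{F}_2$ of rank $N-k$. If $\ker(M)\subseteq\mathbb{F}_2^N$ is a doubly even code, then there are at least $2^{N-k-1}-1$ even invariant factors of the critical group of the (unsigned) Cayley graph $\mathrm{Cayley}(\mathbb{F}_2^{N-k},M)$.
   Context: A linear code $C\subseteq\mathbb{F}_2^N$ is a linear subspace; it is doubly even if every element has weight (number of coordinates equal to $1$) divisible by $4$. $N\ge1$. For an $r\times N$ matrix $M$ over $\mathbb{F}_2$ of rank $r$ with columns $\mathbf{g}_1,\ldots,\mathbf{g}_N$ (which generate $\mathbb{F}_2^r$), $\mathrm{Cayley}(\mathbb{F}_2^r,M)$ is the undirected graph with vertex set $\mathbb{F}_2^r$ and, for every vertex $h$ and every $i$, an edge labeled $i$ joining $h$ and $h+\mathbf{g}_i$. The (unsigned) Laplacian of a graph is $D-A$, with $D$ the diagonal degree matrix and $A$ the $0/1$ adjacency matrix. For a connected graph with $n$ vertices, the Smith Normal Form of the Laplacian over $\mathbb{Z}$ has nonnegative diagonal entries $d_1\mid\cdots\mid d_n$ with $d_n=0$ and $d_1,\ldots,d_{n-1}\neq0$; the critical group is $\mathbb{Z}/d_1\oplus\cdots\oplus\mathbb{Z}/d_{n-1}$ and its invariant factors are $d_1,\ldots,d_{n-1}$, counted with multiplicity. *)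

theory Defs
  imports
    "HOL-Library.Z2"
    "Jordan_Normal_Form.DL_Rank"
    "Jordan_Normal_Form.Matrix_Kernel"
    "Graph_Theory.Digraph"
begin

text \<open>The field with two elements is the type \<^typ>\<open>bit\<close>.\<close>

definition hamming_weight :: "bit vec \<Rightarrow> nat" where
  "hamming_weight v = card {i. i < dim_vec v \<and> v $ i = 1}"

definition linear_code :: "nat \<Rightarrow> bit vec set \<Rightarrow> bool" where
  "linear_code N C \<longleftrightarrow> VectorSpace.subspace class_ring C (module_vec TYPE(bit) N)"

definition doubly_even_code :: "nat \<Rightarrow> bit vec set \<Rightarrow> bool" where
  "doubly_even_code N C \<longleftrightarrow> linear_code N C \<and> (\<forall>c\<in>C. 4 dvd hamming_weight c)"

text \<open>
  As usual in \<^theory>\<open>Graph_Theory.Digraph\<close>, an undirected graph is a symmetric digraph: the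
  undirected edge with label \<open>i\<close> (counted from \<open>0\<close>) joining \<open>h\<close> and \<open>h + g\<close>, where \<open>g\<close> is
  column \<open>i\<close>, is the pair of opposite arcs \<open>(h, i)\<close> and \<open>(h + g, i)\<close>.  The two arcs are
  distinct exactly when \<open>g\<close> is nonzero; if all columns are nonzero, the undirected degree of a
  vertex is its out-degree.
\<close>

definition cayley_graph :: "bit mat \<Rightarrow> (bit vec, bit vec \<times> nat) pre_digraph" where
  "cayley_graph M =
     \<lparr> verts = carrier_vec (dim_row M),
       arcs = carrier_vec (dim_row M) \<times> {..<dim_col M},
       tail = fst,
       head = (\<lambda>(h, i). h + col M i) \<rparr>"

text \<open>
  The matrices below are indexed by the positions in a list \<open>vs\<close> enumerating the vertices.
  The adjacency matrix has entries \<open>0\<close> and \<open>1\<close> only, so this is the intended Laplacian for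
  graphs without loops and parallel edges.
\<close>

definition adjacency_mat :: "('a, 'b) pre_digraph \<Rightarrow> 'a list \<Rightarrow> int mat" where
  "adjacency_mat G vs =
     mat (length vs) (length vs) (\<lambda>(i, j). if (vs ! i, vs ! j) \<in> arcs_ends G then 1 else 0)"

definition degree_mat :: "('a, 'b) pre_digraph \<Rightarrow> 'a list \<Rightarrow> int mat" where
  "degree_mat G vs =
     mat (length vs) (length vs) (\<lambda>(i, j). if i = j then int (out_degree G (vs ! i)) else 0)"

definition laplacian_mat :: "('a, 'b) pre_digraph \<Rightarrow> 'a list \<Rightarrow> int mat" where
  "laplacian_mat G vs = degree_mat G vs - adjacency_mat G vs"

text \<open>
  \<^const>\<open>invertible_mat\<close> over the integers means unimodular.  Since \<open>0\<close> divides only \<open>0\<close>,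
  the divisibility chain puts all zero entries at the end of the diagonal.
\<close>

definition is_smith_normal_form :: "int mat \<Rightarrow> int mat \<Rightarrow> bool" where
  "is_smith_normal_form A S \<longleftrightarrow>
     (\<exists>P Q. P \<in> carrier_mat (dim_row A) (dim_row A) \<and> invertible_mat P \<and>
            Q \<in> carrier_mat (dim_col A) (dim_col A) \<and> invertible_mat Q \<and>
            S = P * A * Q) \<and>
     diagonal_mat S \<and>
     (\<forall>i < min (dim_row S) (dim_col S). 0 \<le> S $$ (i, i)) \<and>
     (\<forall>i. Suc i < min (dim_row S) (dim_col S) \<longrightarrow> S $$ (i, i) dvd S $$ (Suc i, Suc i))"

text \<open>
  For a connected graph on \<open>n\<close> vertices, the Smith normal form of the Laplacian has diagonal
  \<open>d\<^sub>1, \<dots>, d\<^sub>n\<close> with exactly the last entry zero, and the critical group is the direct sum of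
  the cyclic groups of orders \<open>d\<^sub>1, \<dots>, d\<^bsub>n-1\<^esub>\<close>.  Its invariant factors are the list of all these
  numbers, including those equal to \<open>1\<close>.  Reordering the vertices does not change the Smith normal
  form, which exists and is unique, so the list \<open>ds\<close> below is determined by \<open>G\<close>.
\<close>

definition critical_group_invariant_factors :: "('a, 'b) pre_digraph \<Rightarrow> int list \<Rightarrow> bool" where
  "critical_group_invariant_factors G ds \<longleftrightarrow>
     (\<exists>vs S. distinct vs \<and> set vs = verts G \<and>
             is_smith_normal_form (laplacian_mat G vs) S \<and>
             ds = map (\<lambda>i. S $$ (i, i)) [0..<length vs - 1])"

end

theory Submission
  imports Defs
begin

text \<open>
  Put \<open>r = N - k\<close> and let \<open>L\<close> be the Laplacian, of size \<open>n = 2\<^sup>r\<close>.  The point is that \<open>L\<close>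
  squares to zero modulo \<open>2\<close>, which forces its rank over the field with two elements to be at
  most \<open>n / 2 = 2\<^bsup>r-1\<^esup>\<close>.  That rank is the number of odd diagonal entries of the Smith normal
  form, so at least \<open>2\<^bsup>r-1\<^esup>\<close> of the \<open>n\<close> diagonal entries are even; the last one is not an
  invariant factor, which accounts for the \<open>-1\<close> in the bound.

  Why \<open>L\<^sup>2\<close> vanishes modulo \<open>2\<close>: a doubly even kernel has no word of weight \<open>2\<close>, so the columns
  of \<open>M\<close> are pairwise distinct.  Hence the adjacency matrix is the sum of the \<open>N\<close> translation
  matrices \<open>T\<^sub>g\<close>, one for each column \<open>g\<close>.  These commute and satisfy \<open>T\<^sub>g\<^sup>2 = 1\<close>, so modulo
  \<open>2\<close> the square of \<open>L = N + \<Sum>T\<^sub>g\<close> is \<open>N\<^sup>2 + N = 0\<close>.  At the level of entries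
  (\<open>even_square_laplacian_cayley_graph\<close>) the cancellation comes from the symmetry
  \<open>v \<mapsto> u + w + v\<close>, which pairs off the two-step walks from \<open>u\<close> to \<open>w\<close>.

  The rank bound is obtained without passing to the field with two elements
  (\<open>card_unit_diagonal_of_square_zero_mod_prime\<close>).  If \<open>S = P L Q\<close> with \<open>P\<close>, \<open>Q\<close> unimodular and
  \<open>R = Q\<^bsup>-1\<^esup> P\<^bsup>-1\<^esup>\<close>, then \<open>S R S = P L\<^sup>2 Q\<close> is even.  As \<open>S\<close> is diagonal, the block of \<open>R\<close> on the
  rows and columns where \<open>S\<close> is odd consists of even numbers; if that block had more than \<open>n / 2\<close>
  rows, then the determinant of \<open>R\<close> would be even, whereas it is a unit.
\<close>

section \<open>Matrices whose square vanishes modulo a prime\<close>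

text \<open>
  More than half of the indices cannot be mapped into the complement by a permutation, so every
  term of the Leibniz expansion contains a factor from the block.
\<close>

lemma dvd_det_of_large_block:
  fixes R :: "'a :: comm_ring_1 mat"
  assumes R: "R \<in> carrier_mat n n"
    and I: "I \<subseteq> {..<n}" "n < 2 * card I"
    and blk: "\<And>i j. i \<in> I \<Longrightarrow> j \<in> I \<Longrightarrow> p dvd R $$ (i, j)"
  shows "p dvd det R"
proof -
  have "p dvd (\<Prod>i = 0..<n. R $$ (i, \<pi> i))" if "\<pi> permutes {0..<n}" for \<pi>
  proof -
    \<comment> \<open>\<open>\<pi> ` I\<close> and \<open>I\<close> both fill more than half of the indices, so they meet.\<close>
    have fin: "finite I" using I(1) finite_subset by blast
    have "card (\<pi> ` I) = card I"
      using that by (intro card_image) (meson permutes_inj_on)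
    moreover have "\<pi> ` I \<union> I \<subseteq> {..<n}"
      using I(1) permutes_in_image[OF that] by fastforce
    then have "card (\<pi> ` I \<union> I) \<le> n"
      using card_mono[of "{..<n}"] by fastforce
    ultimately have "card (\<pi> ` I \<inter> I) \<noteq> 0"
      using card_Un_Int[OF finite_imageI[OF fin] fin, of \<pi>] I(2) by linarith
    then have "\<pi> ` I \<inter> I \<noteq> {}" by force
    then obtain i where i: "i \<in> I" "\<pi> i \<in> I" by blast
    then have "p dvd R $$ (i, \<pi> i)" by (rule blk)
    moreover have "R $$ (i, \<pi> i) dvd (\<Prod>i = 0..<n. R $$ (i, \<pi> i))"
      using i(1) I(1) by (intro dvd_prodI) auto
    ultimately show ?thesis by (rule dvd_trans)
  qed
  then show ?thesis
    unfolding det_def'[OF R] by (intro dvd_sum dvd_mult) auto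
qed

text \<open>
  Modulo \<open>p\<close> this is the inequality \<open>2 rank A \<le> n\<close> for \<open>A\<^sup>2 = 0\<close>: the diagonal entries not
  divisible by \<open>p\<close> count the rank.
\<close>

lemma card_unit_diagonal_of_square_zero_mod_prime:
  fixes A :: "int mat"
  assumes A: "A \<in> carrier_mat n n"
    and P: "P \<in> carrier_mat n n" "invertible_mat P"
    and Q: "Q \<in> carrier_mat n n" "invertible_mat Q"
    and diag: "diagonal_mat (P * A * Q)"
    and p: "prime p"
    and sq: "\<And>i j. i < n \<Longrightarrow> j < n \<Longrightarrow> p dvd (A * A) $$ (i, j)"
  shows "2 * card {i. i < n \<and> \<not> p dvd (P * A * Q) $$ (i, i)} \<le> n"
proof (rule ccontr)
  define S where "S = P * A * Q"
  define I where "I = {i. i < n \<and> \<not> p dvd S $$ (i, i)}"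
  assume "\<not> ?thesis"
  then have large: "n < 2 * card I" by (simp add: I_def S_def)
  have inverse: "\<exists>Y. Y \<in> carrier_mat n n \<and> X * Y = 1\<^sub>m n \<and> Y * X = 1\<^sub>m n"
    if X: "X \<in> carrier_mat n n" "invertible_mat X" for X :: "int mat"
  proof -
    obtain Y where Y: "X * Y = 1\<^sub>m n" "Y * X = 1\<^sub>m (dim_row Y)"
      using X by (auto simp: invertible_mat_def inverts_mat_def)
    have "dim_col Y = n" "dim_row Y = n"
      using arg_cong[OF Y(1), of dim_col] arg_cong[OF Y(2), of dim_col] X by auto
    then show ?thesis using Y by auto
  qed
  obtain P' where P': "P' \<in> carrier_mat n n" "P * P' = 1\<^sub>m n" "P' * P = 1\<^sub>m n"
    using inverse[OF P] by blast
  obtain Q' where Q': "Q' \<in> carrier_mat n n" "Q * Q' = 1\<^sub>m n" "Q' * Q = 1\<^sub>m n"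
    using inverse[OF Q] by blast
  \<comment> \<open>\<open>R\<close> is what stands between the two copies of \<open>S\<close> when \<open>A\<^sup>2\<close> is expressed through
    \<open>A = P\<^bsup>-1\<^esup> S Q\<^bsup>-1\<^esup>\<close>.\<close>
  define R where "R = Q' * P'"
  have R: "R \<in> carrier_mat n n" and S: "S \<in> carrier_mat n n"
    using A P Q P' Q' by (auto simp: R_def S_def)
  have SRS: "S * R * S = P * (A * A) * Q"
  proof -
    have "S * R = P * A * (Q * Q') * P'"
      unfolding S_def R_def using A P(1) Q(1) P'(1) Q'(1)
      by (simp add: assoc_mult_mat[where n\<^sub>1=n and n\<^sub>2=n and n\<^sub>3=n and n\<^sub>4=n])
    also have "\<dots> = P * A * P'" using A P(1) P'(1) by (simp add: Q')
    finally have "S * R * S = P * A * (P' * P) * A * Q"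
      unfolding S_def using A P(1) Q(1) P'(1) Q'(1)
      by (simp add: assoc_mult_mat[where n\<^sub>1=n and n\<^sub>2=n and n\<^sub>3=n and n\<^sub>4=n])
    also have "\<dots> = P * (A * A) * Q"
      using A P(1) Q(1) by (simp add: P' assoc_mult_mat[where n\<^sub>1=n and n\<^sub>2=n and n\<^sub>3=n and n\<^sub>4=n])
    finally show ?thesis .
  qed
  have mult_entry: "(X * Y) $$ (i, j) = (\<Sum>l = 0..<n. X $$ (i, l) * Y $$ (l, j))"
    if "X \<in> carrier_mat n n" "Y \<in> carrier_mat n n" "i < n" "j < n" for X Y :: "int mat" and i j
    using that by (auto simp: scalar_prod_def intro!: sum.cong)
  have mult_dvd: "p dvd (X * Y) $$ (i, j)"
    if "X \<in> carrier_mat n n" "Y \<in> carrier_mat n n" "i < n" "j < n"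
      and "(\<forall>i<n. \<forall>j<n. p dvd X $$ (i, j)) \<or> (\<forall>i<n. \<forall>j<n. p dvd Y $$ (i, j))"
    for X Y i j
    unfolding mult_entry[OF that(1-4)]
    using that(3-5) by (auto intro!: dvd_sum intro: dvd_mult dvd_mult2)
  have "p dvd (P * (A * A)) $$ (i, j)" if "i < n" "j < n" for i j
    by (rule mult_dvd[OF P(1) mult_carrier_mat[OF A A] that]) (use sq in blast)
  then have SRS_dvd: "p dvd (S * R * S) $$ (i, j)" if "i < n" "j < n" for i j
    unfolding SRS
    by (intro mult_dvd[OF mult_carrier_mat[OF P(1) mult_carrier_mat[OF A A]] Q(1) that]) blast
  have S_off: "S $$ (i, j) = 0" if "i < n" "j < n" "i \<noteq> j" for i j
    using diag S that unfolding diagonal_mat_def S_def[symmetric] by auto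
  have SR: "(S * R) $$ (i, j) = S $$ (i, i) * R $$ (i, j)" if "i < n" "j < n" for i j
  proof -
    have "(S * R) $$ (i, j) = (\<Sum>l = 0..<n. S $$ (i, l) * R $$ (l, j))"
      by (rule mult_entry[OF S R that])
    also have "\<dots> = (\<Sum>l = 0..<n. if l = i then S $$ (i, i) * R $$ (i, j) else 0)"
      using S_off that by (intro sum.cong) auto
    finally show ?thesis using that by simp
  qed
  have SRS_entry: "(S * R * S) $$ (i, j) = S $$ (i, i) * R $$ (i, j) * S $$ (j, j)"
    if "i < n" "j < n" for i j
  proof -
    have "(S * R * S) $$ (i, j) = (\<Sum>l = 0..<n. (S * R) $$ (i, l) * S $$ (l, j))"
      by (rule mult_entry[OF mult_carrier_mat[OF S R] S that])
    also have "\<dots> = (\<Sum>l = 0..<n. if l = j then S $$ (i, i) * R $$ (i, j) * S $$ (j, j) else 0)"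
      using S_off SR that by (intro sum.cong) auto
    finally show ?thesis using that by simp
  qed
  have "p dvd det R"
  proof (rule dvd_det_of_large_block[OF R _ large])
    show "I \<subseteq> {..<n}" by (auto simp: I_def)
    fix i j assume "i \<in> I" "j \<in> I"
    then show "p dvd R $$ (i, j)"
      using SRS_dvd[of i j] SRS_entry[of i j] p by (auto simp: I_def prime_dvd_mult_iff)
  qed
  moreover have "R * (P * Q) = 1\<^sub>m n"
  proof -
    have "R * (P * Q) = Q' * (P' * P) * Q"
      unfolding R_def using P(1) Q(1) P'(1) Q'(1)
      by (simp add: assoc_mult_mat[where n\<^sub>1=n and n\<^sub>2=n and n\<^sub>3=n and n\<^sub>4=n])
    then show ?thesis using Q'(1) by (simp add: P' Q')
  qed
  then have "det R * det (P * Q) = 1"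
    using det_mult[OF R, of "P * Q"] P(1) Q(1) by simp
  ultimately have "p dvd 1" by (metis dvd_mult2)
  then show False using p not_prime_unit by blast
qed

section \<open>The Laplacian of a binary Cayley graph\<close>

lemma bit_vec_add_cancel:
  fixes u v :: "bit vec"
  assumes "u \<in> carrier_vec r" "v \<in> carrier_vec r"
  shows "u + v + v = u"
  using assms by (intro eq_vecI) (auto simp: add.assoc)

lemma card_carrier_vec_bit: "card (carrier_vec r :: bit vec set) = 2 ^ r"
proof -
  let ?lists = "{xs :: bit list. set xs \<subseteq> {0, 1} \<and> length xs = r}"
  have "b \<in> {0, 1}" for b :: bit by (cases b) simp_all
  then have lists: "xs \<in> ?lists \<longleftrightarrow> length xs = r" for xs by blast
  have "bij_betw vec_of_list ?lists (carrier_vec r)"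
  proof (rule bij_betw_byWitness[where f' = list_of_vec])
    show "vec_of_list ` ?lists \<subseteq> carrier_vec r"
    proof (rule image_subsetI)
      fix xs assume "xs \<in> ?lists"
      then show "vec_of_list xs \<in> carrier_vec r"
        by (intro carrier_vecI) (simp only: lists dim_vec_of_list)
    qed
    show "list_of_vec ` carrier_vec r \<subseteq> ?lists"
    proof (rule image_subsetI)
      fix v :: "bit vec" assume "v \<in> carrier_vec r"
      then show "list_of_vec v \<in> ?lists"
        unfolding lists length_list_of_vec by (rule carrier_vecD)
    qed
  qed (intro ballI vec_list list_vec)+
  then have "card (carrier_vec r :: bit vec set) = card ?lists"
    by (rule bij_betw_same_card[symmetric])
  also have "\<dots> = card {0, 1 :: bit} ^ r"
    by (rule card_lists_length_eq) simp
  also have "card {0, 1 :: bit} = 2" by simp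
  finally show ?thesis .
qed

lemma even_sum_fixpoint_free_involution:
  fixes f :: "'a \<Rightarrow> int"
  assumes "finite A"
    and "\<And>x. x \<in> A \<Longrightarrow> \<tau> x \<in> A"
    and "\<And>x. x \<in> A \<Longrightarrow> \<tau> (\<tau> x) = x"
    and "\<And>x. x \<in> A \<Longrightarrow> \<tau> x \<noteq> x"
    and "\<And>x. x \<in> A \<Longrightarrow> f (\<tau> x) = f x"
  shows "even (sum f A)"
  using assms
proof (induction "card A" arbitrary: A rule: less_induct)
  case less
  show ?case
  proof (cases "A = {}")
    case False
    then obtain x where x: "x \<in> A" by blast
    let ?B = "A - {x, \<tau> x}"
    have "card ?B < card A"
      using x less.prems(1) by (intro psubset_card_mono) auto
    moreover have "\<tau> y \<in> ?B" if "y \<in> ?B" for y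
      using that x less.prems(2) less.prems(3)[of y] less.prems(3)[OF x] by auto
    ultimately have "even (sum f ?B)"
      using less.prems by (intro less.hyps) auto
    moreover have "sum f A = sum f ?B + sum f {x, \<tau> x}"
      using x less.prems by (intro sum.subset_diff) auto
    moreover have "sum f {x, \<tau> x} = 2 * f x"
      using less.prems(4,5)[OF x] by auto
    ultimately show ?thesis by simp
  qed simp
qed

text \<open>
  Two equal columns \<open>i \<noteq> j\<close> would put the word \<open>e\<^sub>i + e\<^sub>j\<close>, of weight \<open>2\<close>, into the kernel.
\<close>

lemma inj_on_col_if_doubly_even_kernel:
  assumes M: "M \<in> carrier_mat r N"
    and de: "doubly_even_code N (mat_kernel M)"
  shows "inj_on (col M) {..<N}"
proof (rule inj_onI, rule ccontr)
  fix i j assume ij: "i \<in> {..<N}" "j \<in> {..<N}" and eq: "col M i = col M j" and ne: "i \<noteq> j"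
  define c :: "bit vec" where "c = unit_vec N i + unit_vec N j"
  have "M *\<^sub>v unit_vec N l = col M l" if "l < N" for l
    using M that by (intro eq_vecI) auto
  then have "M *\<^sub>v c = col M i + col M j"
    unfolding c_def using ij by (simp add: mult_add_distrib_mat_vec[OF M])
  also have "\<dots> = 0\<^sub>v r" unfolding eq using M by (intro eq_vecI) auto
  finally have "c \<in> mat_kernel M"
    using M by (auto simp: mat_kernel_def c_def)
  then have "4 dvd hamming_weight c" using de by (auto simp: doubly_even_code_def)
  moreover have "{l. l < dim_vec c \<and> c $ l = 1} = {i, j}"
    using ij ne by (auto simp: c_def unit_vec_def split: if_splits)
  then have "hamming_weight c = 2" using ne by (simp add: hamming_weight_def)
  ultimately show False by simp
qed

lemma out_degree_cayley_graph:
  assumes "u \<in> carrier_vec (dim_row M)"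
  shows "out_degree (cayley_graph M) u = dim_col M"
proof -
  have "out_arcs (cayley_graph M) u = Pair u ` {..<dim_col M}"
    using assms by (auto simp: out_arcs_def cayley_graph_def)
  then show ?thesis by (simp add: out_degree_def card_image inj_on_def)
qed

lemma arcs_ends_cayley_graph_iff:
  assumes "u \<in> carrier_vec (dim_row M)" "v \<in> carrier_vec (dim_row M)"
  shows "(u, v) \<in> arcs_ends (cayley_graph M) \<longleftrightarrow> u + v \<in> col M ` {..<dim_col M}"
proof -
  have "(u, v) \<in> arcs_ends (cayley_graph M) \<longleftrightarrow> (\<exists>i<dim_col M. v = u + col M i)"
    using assms by (auto simp: arcs_ends_def arc_to_ends_def cayley_graph_def image_iff)
  also have "\<dots> \<longleftrightarrow> (\<exists>i<dim_col M. u + v = col M i)"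
  proof -
    have "v = u + g \<longleftrightarrow> u + v = g" if "g \<in> carrier_vec (dim_row M)" for g
      using assms that bit_vec_add_cancel comm_add_vec by (metis add_carrier_vec)
    then show ?thesis by (metis col_dim)
  qed
  finally show ?thesis by auto
qed

text \<open>
  The Laplacian entry at \<open>(u, v)\<close> is a function \<open>\<mu> (u + v)\<close>, so the entry of the square at \<open>(u, w)\<close>
  is the sum of \<open>\<mu> (u + v) \<mu> (v + w)\<close> over all \<open>v\<close>.  For \<open>u \<noteq> w\<close> the translation by \<open>u + w\<close>
  swaps the two factors and has no fixed point, so the terms come in equal pairs.  For \<open>u = w\<close> the
  sum of the squares has the parity of the sum of the \<open>\<mu> (u + v)\<close>, a row sum of the Laplacian,
  which is \<open>0\<close>.  Distinct columns make the vertex degree \<open>N\<close> agree with the number of ones in a row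
  of the adjacency matrix.
\<close>

lemma even_square_laplacian_cayley_graph:
  assumes M: "M \<in> carrier_mat r N"
    and inj: "inj_on (col M) {..<N}"
    and vs: "distinct vs" "set vs = carrier_vec r"
    and ij: "i < length vs" "j < length vs"
  defines "L \<equiv> laplacian_mat (cayley_graph M) vs"
  shows "even ((L * L) $$ (i, j))"
proof -
  let ?V = "carrier_vec r :: bit vec set"
  define C where "C = col M ` {..<N}"
  define \<mu> :: "bit vec \<Rightarrow> int" where
    "\<mu> x = (if x = 0\<^sub>v r then int N else 0) - (if x \<in> C then 1 else 0)" for x
  define u w where "u = vs ! i" and "w = vs ! j"
  have V: "u \<in> ?V" "w \<in> ?V" using ij vs(2) nth_mem unfolding u_def w_def by blast+
  have finV: "finite ?V" using vs(2) by (metis List.finite_set)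
  have C: "C \<subseteq> ?V" "card C = N"
    using M inj by (auto simp: C_def card_image)
  have zero_iff: "x + y = 0\<^sub>v r \<longleftrightarrow> x = y" if "x \<in> ?V" "y \<in> ?V" for x y
  proof
    assume "x + y = 0\<^sub>v r"
    then show "x = y" using bit_vec_add_cancel[OF that] that by simp
  next
    assume "x = y"
    then show "x + y = 0\<^sub>v r" using that by (intro eq_vecI) auto
  qed
  have entry: "L $$ (a, b) = \<mu> (vs ! a + vs ! b)" if "a < length vs" "b < length vs" for a b
  proof -
    have "vs ! a \<in> ?V" "vs ! b \<in> ?V" using that vs(2) nth_mem by blast+
    then show ?thesis
      using that M vs(1) zero_iff[of "vs ! a" "vs ! b"]
        arcs_ends_cayley_graph_iff[of "vs ! a" M "vs ! b"] out_degree_cayley_graph[of "vs ! a" M]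
      by (auto simp: L_def laplacian_mat_def degree_mat_def adjacency_mat_def \<mu>_def C_def
          nth_eq_iff_index_eq)
  qed
  have L: "L \<in> carrier_mat (length vs) (length vs)"
    by (auto simp: L_def laplacian_mat_def degree_mat_def adjacency_mat_def)
  have "(L * L) $$ (i, j) = (\<Sum>l<length vs. \<mu> (u + vs ! l) * \<mu> (vs ! l + w))"
    using L ij by (auto simp: scalar_prod_def entry u_def w_def lessThan_atLeast0 intro!: sum.cong)
  also have "\<dots> = (\<Sum>v\<in>?V. \<mu> (u + v) * \<mu> (v + w))"
    by (rule sum.reindex_bij_betw[OF bij_betw_nth]) (use vs in auto)
  finally have LL: "(L * L) $$ (i, j) = (\<Sum>v\<in>?V. \<mu> (u + v) * \<mu> (v + w))" .
  show ?thesis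
  proof (cases "u = w")
    case True
    have "u + (u + v) = v" if "v \<in> ?V" for v
      using that V(1) by (metis add_carrier_vec bit_vec_add_cancel comm_add_vec)
    then have "bij_betw ((+) u) ?V ?V"
      using V(1) by (intro bij_betw_byWitness[where f' = "(+) u"]) auto
    then have "(\<Sum>v\<in>?V. \<mu> (u + v)) = (\<Sum>x\<in>?V. \<mu> x)"
      by (rule sum.reindex_bij_betw)
    also have "\<dots> = int N - int (card (?V \<inter> C))"
      using finV by (simp add: \<mu>_def sum_subtractf sum.If_cases)
    also have "\<dots> = 0" using C by (simp add: Int_absorb1)
    finally have "even (\<Sum>v\<in>?V. \<mu> (u + v))" by simp
    moreover have "even (\<Sum>v\<in>?V. \<mu> (u + v) * \<mu> (v + w) - \<mu> (u + v))"
    proof (rule dvd_sum)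
      fix v assume "v \<in> ?V"
      then have "v + w = u + v" using True V comm_add_vec by blast
      then show "even (\<mu> (u + v) * \<mu> (v + w) - \<mu> (u + v))" by simp
    qed
    ultimately show ?thesis by (simp add: LL sum_subtractf)
  next
    case False
    have "x + (x + y) = y" for x y :: bit by (cases x; cases y) simp_all
    then have mirror: "u + (v + (u + w)) = v + w" "v + (u + w) + w = u + v" if "v \<in> ?V" for v
      using that V by (auto intro!: eq_vecI simp: ac_simps)
    show ?thesis
      unfolding LL
    proof (rule even_sum_fixpoint_free_involution[OF finV, where \<tau> = "\<lambda>v. v + (u + w)"])
      fix v assume v: "v \<in> ?V"
      show "v + (u + w) \<in> ?V" using v V by simp
      show "v + (u + w) + (u + w) = v" using v V by (intro bit_vec_add_cancel) auto
      show "v + (u + w) \<noteq> v"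
      proof
        assume "v + (u + w) = v"
        then have "u + w = 0\<^sub>v r"
          using zero_iff[OF v v] v V
          by (metis add_carrier_vec bit_vec_add_cancel comm_add_vec)
        then show False using False zero_iff V by blast
      qed
      show "\<mu> (u + (v + (u + w))) * \<mu> (v + (u + w) + w) = \<mu> (u + v) * \<mu> (v + w)"
        using mirror[OF v] by simp
    qed
  qed
qed

section \<open>Even invariant factors\<close>

theorem proposition41:
  fixes N k :: nat and M :: "bit mat" and ds :: "int list"
  assumes "1 \<le> N" and "k \<le> N"
    and "M \<in> carrier_mat (N - k) N"
    and "vec_space.rank (N - k) M = N - k"
    and "doubly_even_code N (mat_kernel M)"
    and "critical_group_invariant_factors (cayley_graph M) ds"
  shows "2 ^ (N - k - 1) - 1 \<le> length (filter even ds)"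
proof (cases "N - k = 0")
  \<comment> \<open>For \<open>N = k\<close> the claimed bound is \<open>2 ^ 0 - 1 = 0\<close>, by truncated subtraction in the exponent.\<close>
  case False
  define r where "r = N - k"
  note M = assms(3)[folded r_def]
  obtain vs S where vs: "distinct vs" "set vs = verts (cayley_graph M)"
    and ds: "ds = map (\<lambda>i. S $$ (i, i)) [0..<length vs - 1]"
    and snf: "is_smith_normal_form (laplacian_mat (cayley_graph M) vs) S"
    using assms(6) unfolding critical_group_invariant_factors_def by blast
  define n where "n = length vs"
  define L where "L = laplacian_mat (cayley_graph M) vs"
  have V: "set vs = carrier_vec r" using vs(2) M by (simp add: cayley_graph_def)
  have n: "n = 2 * 2 ^ (r - 1)"
    using distinct_card[OF vs(1)] False
    by (cases r) (simp_all add: V card_carrier_vec_bit n_def r_def[symmetric])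
  have L: "L \<in> carrier_mat n n"
    by (auto simp: L_def n_def laplacian_mat_def degree_mat_def adjacency_mat_def)
  obtain P Q where PQ: "P \<in> carrier_mat n n" "invertible_mat P" "Q \<in> carrier_mat n n"
      "invertible_mat Q" and S: "S = P * L * Q" and diag: "diagonal_mat S"
    using snf L unfolding is_smith_normal_form_def L_def[symmetric] by auto
  define odds where "odds = {i. i < n \<and> odd (S $$ (i, i))}"
  have "2 * card odds \<le> n"
    unfolding odds_def S
  proof (rule card_unit_diagonal_of_square_zero_mod_prime[OF L PQ])
    show "diagonal_mat (P * L * Q)" using diag by (simp add: S)
    show "even ((L * L) $$ (i, j))" if "i < n" "j < n" for i j
      using even_square_laplacian_cayley_graph[OF M _ vs(1) V] that
        inj_on_col_if_doubly_even_kernel[OF M assms(5)] by (simp add: L_def n_def)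
  qed simp
  moreover have "length (filter even ds) = card ({..<n - 1} - odds)"
  proof -
    have "length (filter even ds) = card {i. i < n - 1 \<and> even (S $$ (i, i))}"
      unfolding ds n_def[symmetric] by (auto simp: length_filter_conv_card intro!: arg_cong[of _ _ card])
    also have "{i. i < n - 1 \<and> even (S $$ (i, i))} = {..<n - 1} - odds"
      by (auto simp: odds_def)
    finally show ?thesis .
  qed
  moreover have "card {..<n - 1} - card odds \<le> card ({..<n - 1} - odds)"
    by (rule diff_card_le_card_Diff) (simp add: odds_def)
  ultimately show ?thesis
    using n unfolding r_def[symmetric] card_lessThan by linarith
qed simp

end
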